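(* Almost all shifted matroids are not threshold. That is, if $\mathrm{Th}(n)$ denotes the number of isomorphism classes of threshold matroids on a ground set of size $n$ and $\mathrm{Sh}(n)$ denotes the number of isomorphism classes of shifted matroids on a ground set of size $n$ (matroids of all ranks counted), then \[\lim_{n\to\infty}\frac{\mathrm{Th}(n)}{\mathrm{Sh}(n)}=0.\]
   Context: Matroids are given by their bases. For $S=\{s_1<\dots<s_k\}$ and $T=\{t_1<\dots<t_k\}$ in $\binom{[n]}{k}$, the component-wise partial order declares $S\prec T$ if $s_i\le t_i$ for all $i$. For $T\in\binom{[n]}{k}$, $\langle T\rangle$ denotes the matroid on $[n]$ whose set of bases is $\{S\in\binom{[n]}{k}: S\prec T\}$. A matroid is shifted if it is isomorphic to a matroid on $[n]$ whose bases form an order ideal of $\binom{[n]}{k}$ under $\prec$ (equivalently, isomorphic to $\langle T\rangle$ for some $T$). A rank $k$ matroid $M$ on ground set $E$ is threshold if there is $w:E\to\mathbb{R}$ such that for every $k$-element subset $B\subseteq E$, $B$ is a basis of $M$ if and only if $\sum_{b\in B}w(b)>0$. *)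

theory Defs
  imports Complex_Main "HOL-Library.Ramsey"
begin

(* A matroid is a pair (ground set, set of bases). *)
type_synonym 'a bases_pair = "'a set \<times> 'a set set"

abbreviation ground :: "'a bases_pair \<Rightarrow> 'a set" where
  "ground \<equiv> fst"

abbreviation bases :: "'a bases_pair \<Rightarrow> 'a set set" where
  "bases \<equiv> snd"

definition matroid :: "'a bases_pair \<Rightarrow> bool" where
  "matroid M \<longleftrightarrow>
     finite (ground M) \<and> bases M \<subseteq> Pow (ground M) \<and> bases M \<noteq> {} \<and>
     (\<forall>A\<in>bases M. \<forall>B\<in>bases M. \<forall>x\<in>A - B. \<exists>y\<in>B - A. insert y (A - {x}) \<in> bases M)"

definition has_rank :: "'a bases_pair \<Rightarrow> nat \<Rightarrow> bool" where
  "has_rank M k \<longleftrightarrow> (\<forall>B\<in>bases M. card B = k)"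

lemma matroid_card_bases_eq:
  assumes "matroid M" "A \<in> bases M" "B \<in> bases M"
  shows "card A = card B"
  using assms(2)
proof (induction "card (A - B)" arbitrary: A rule: less_induct)
  case less
  have fin: "finite A"
    using assms(1) less.prems unfolding matroid_def
    by (meson PowD finite_subset subsetD)
  have exch: "\<exists>y\<in>D - C. insert y (C - {x}) \<in> bases M"
    if "C \<in> bases M" "D \<in> bases M" "x \<in> C - D" for C D x
    using assms(1) that unfolding matroid_def by blast
  show ?case
  proof (cases "A - B = {}")
    case True
    then have "B - A = {}"
      using exch[OF assms(3) less.prems] by blast
    with True show ?thesis by (metis Diff_eq_empty_iff subset_antisym)
  next
    case False
    then obtain x where x: "x \<in> A - B" by blast
    obtain y where y: "y \<in> B - A" "insert y (A - {x}) \<in> bases M"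
      using exch[OF less.prems assms(3) x] by blast
    have "insert y (A - {x}) - B \<subset> A - B" using x y by auto
    then have "card (insert y (A - {x}) - B) < card (A - B)"
      using fin by (intro psubset_card_mono) auto
    then have "card (insert y (A - {x})) = card B"
      using less.hyps y(2) by blast
    moreover have "card (insert y (A - {x})) = card A"
      using x y fin card_Suc_Diff1[of A x] by simp
    ultimately show ?thesis by simp
  qed
qed

(* The rank of a matroid exists and is unique. *)
lemma matroid_ex1_rank: "matroid M \<Longrightarrow> \<exists>!k. has_rank M k"
proof -
  assume M: "matroid M"
  then obtain B where B: "B \<in> bases M" unfolding matroid_def by blast
  show ?thesis
  proof (rule ex1I)
    show "has_rank M (card B)"
      using matroid_card_bases_eq[OF M _ B] by (simp add: has_rank_def)
    show "k = card B" if "has_rank M k" for k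
      using that B by (simp add: has_rank_def)
  qed
qed

definition matroid_iso :: "'a bases_pair \<Rightarrow> 'b bases_pair \<Rightarrow> bool" where
  "matroid_iso M N \<longleftrightarrow>
     (\<exists>f. bij_betw f (ground M) (ground N) \<and> bases N = (\<lambda>B. f ` B) ` bases M)"

(* The order is only meant for finite sets of equal size; list_all2 enforces equal size. *)
definition componentwise_le :: "nat set \<Rightarrow> nat set \<Rightarrow> bool" (infix "\<preceq>\<^sub>c" 50) where
  "S \<preceq>\<^sub>c T \<longleftrightarrow> list_all2 (\<le>) (sorted_list_of_set S) (sorted_list_of_set T)"

(* nsets A k is the set of k-element subsets of A. *)
definition order_ideal :: "nat \<Rightarrow> nat \<Rightarrow> nat set set \<Rightarrow> bool" where
  "order_ideal n k I \<longleftrightarrow>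
     I \<subseteq> nsets {1..n} k \<and> (\<forall>T\<in>I. \<forall>S\<in>nsets {1..n} k. S \<preceq>\<^sub>c T \<longrightarrow> S \<in> I)"

definition shifted :: "'a bases_pair \<Rightarrow> bool" where
  "shifted M \<longleftrightarrow> matroid M \<and>
     (\<exists>n k N. matroid N \<and> ground N = {1..n} \<and> order_ideal n k (bases N) \<and> matroid_iso M N)"

definition threshold :: "'a bases_pair \<Rightarrow> bool" where
  "threshold M \<longleftrightarrow> matroid M \<and>
     (\<exists>k (w :: 'a \<Rightarrow> real). has_rank M k \<and>
        (\<forall>B\<in>nsets (ground M) k. B \<in> bases M \<longleftrightarrow> sum w B > 0))"

definition iso_rel :: "'a bases_pair set \<Rightarrow> ('a bases_pair \<times> 'a bases_pair) set" where
  "iso_rel C = {(M, N). M \<in> C \<and> N \<in> C \<and> matroid_iso M N}"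

(* Every matroid on n elements is isomorphic to one on {1..n}, so it suffices to take
   the isomorphism classes of matroids on that ground set. *)
definition num_iso_classes :: "(nat bases_pair \<Rightarrow> bool) \<Rightarrow> nat \<Rightarrow> nat" where
  "num_iso_classes P n =
     (let C = {M. matroid M \<and> ground M = {1..n} \<and> P M} in card (C // iso_rel C))"

definition Th :: "nat \<Rightarrow> nat" where
  "Th n = num_iso_classes threshold n"

definition Sh :: "nat \<Rightarrow> nat" where
  "Sh n = num_iso_classes shifted n"

lemma equiv_iso_rel:
  assumes "\<And>M. M \<in> C \<Longrightarrow> matroid M"
  shows "equiv C (iso_rel C)"
proof (rule equivI)
  show "iso_rel C \<subseteq> C \<times> C" by (auto simp: iso_rel_def)
  have "matroid_iso M M" for M :: "'a bases_pair"
    unfolding matroid_iso_def by (intro exI[of _ id]) auto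
  then show "refl_on C (iso_rel C)" by (auto simp: refl_on_def iso_rel_def)
  have "matroid_iso N M" if M: "M \<in> C" and iso: "matroid_iso M N" for M N :: "'a bases_pair"
  proof -
    obtain f where f: "bij_betw f (ground M) (ground N)" "bases N = (\<lambda>B. f ` B) ` bases M"
      using iso unfolding matroid_iso_def by blast
    let ?g = "the_inv_into (ground M) f"
    have "?g ` f ` B = B" if "B \<in> bases M" for B
    proof -
      have "B \<subseteq> ground M" using assms[OF M] that unfolding matroid_def by blast
      then have "\<forall>x\<in>B. ?g (f x) = x"
        using f(1) by (auto simp: bij_betw_def intro: the_inv_into_f_f)
      then show ?thesis by (simp add: image_image)
    qed
    then have "(\<lambda>B. ?g ` f ` B) ` bases M = bases M"
      by simp
    then have "bases M = (\<lambda>B. ?g ` B) ` bases N"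
      unfolding f(2) image_image[of "\<lambda>B. ?g ` B"] by (rule sym)
    then show ?thesis
      using bij_betw_the_inv_into[OF f(1)] unfolding matroid_iso_def by blast
  qed
  then show "sym (iso_rel C)" by (auto simp: sym_def iso_rel_def)
  have "matroid_iso L N" if iso: "matroid_iso L M" "matroid_iso M N" for L M N :: "'a bases_pair"
  proof -
    obtain f where f: "bij_betw f (ground L) (ground M)" "bases M = (\<lambda>B. f ` B) ` bases L"
      using iso(1) unfolding matroid_iso_def by (elim exE conjE)
    obtain g where g: "bij_betw g (ground M) (ground N)" "bases N = (\<lambda>B. g ` B) ` bases M"
      using iso(2) unfolding matroid_iso_def by (elim exE conjE)
    have "bases N = (\<lambda>B. (g \<circ> f) ` B) ` bases L"
      unfolding f(2) g(2) by (simp add: image_image)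
    then show ?thesis
      using bij_betw_trans[OF f(1) g(1)] unfolding matroid_iso_def
      by (intro exI[of _ "g \<circ> f"] conjI)
  qed
  then show "trans (iso_rel C)"
    by (intro transI) (auto simp: iso_rel_def)
qed

end

theory Submission
  imports Defs
begin

text \<open>Write a subset of \<open>{1..n}\<close> as a 0/1 sequence. The \<open>2\<^sup>n\<close> matroids \<open>\<langle>T\<rangle>\<close> are pairwise
  non-isomorphic. A threshold matroid is some \<open>\<langle>T\<rangle>\<close> once its elements are sorted by decreasing
  weight, and then \<open>T\<close> cannot contain \<open>01010101\<close> as a subsequence: moving ones of \<open>T\<close> within such
  a pattern gives two bases and two non-bases that cover every element equally often. So \<open>T\<close>
  has a bounded number of blocks, which leaves only polynomially many choices.\<close>

section \<open>The matroids \<open>\<langle>T\<rangle>\<close>\<close>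

text \<open>The component-wise order in counting form: for finite sets of equal size, the i-th
  smallest elements compare for all i exactly when no threshold \<open>t\<close> has more elements
  of \<open>S\<close> than of \<open>T\<close> above it. Counts are easier to follow through an
  exchange of elements than sorted lists.\<close>

definition gale_le :: "nat set \<Rightarrow> nat set \<Rightarrow> bool" where
  "gale_le S T \<longleftrightarrow> card S = card T \<and> (\<forall>t. card (S \<inter> {t<..}) \<le> card (T \<inter> {t<..}))"

definition principal_matroid :: "nat \<Rightarrow> nat set \<Rightarrow> nat bases_pair" where
  "principal_matroid n T = ({1..n}, {S. S \<subseteq> {1..n} \<and> gale_le S T})"

lemma ground_principal_matroid [simp]: "ground (principal_matroid n T) = {1..n}"
  by (simp add: principal_matroid_def)

lemma mem_bases_principal_matroid [simp]:
  "S \<in> bases (principal_matroid n T) \<longleftrightarrow> S \<subseteq> {1..n} \<and> gale_le S T"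
  by (simp add: principal_matroid_def)

lemma gale_le_refl [simp]: "gale_le S S"
  by (simp add: gale_le_def)

lemma gale_le_trans: "gale_le R S \<Longrightarrow> gale_le S T \<Longrightarrow> gale_le R T"
  unfolding gale_le_def by (metis le_trans)

text \<open>Consecutive counts above \<open>t\<close> and \<open>Suc t\<close> differ exactly when
  \<open>Suc t\<close> is an element, so the counts determine the set away from 0.\<close>

lemma gale_le_antisym:
  assumes "finite S" "finite T" "gale_le S T" "gale_le T S"
  shows "S = T"
proof -
  have eq: "card (S \<inter> {t<..}) = card (T \<inter> {t<..})" for t
    using assms(3,4) by (simp add: gale_le_def order_antisym)
  have ind: "card (X \<inter> {t<..}) = card (X \<inter> {Suc t<..}) + (if Suc t \<in> X then 1 else 0)"
    if "finite X" for X t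
  proof (cases "Suc t \<in> X")
    case True
    then have "X \<inter> {t<..} = insert (Suc t) (X \<inter> {Suc t<..})"
      by auto
    with True that show ?thesis by simp
  next
    case False
    then have "X \<inter> {t<..} = X \<inter> {Suc t<..}"
      by (auto intro!: Suc_lessI)
    with False show ?thesis by simp
  qed
  have pos: "Suc t \<in> S \<longleftrightarrow> Suc t \<in> T" for t
    using ind[OF assms(1), of t] ind[OF assms(2), of t] eq[of t] eq[of "Suc t"]
    by (auto split: if_splits)
  \<comment> \<open>No set \<open>{t<..}\<close> contains 0, so membership of 0 is read off from the
    total cardinality.\<close>
  have zero: "card X = card (X \<inter> {0<..}) + (if 0 \<in> X then 1 else 0)" if "finite X" for X :: "nat set"
  proof (cases "0 \<in> X")
    case True
    then have "X = insert 0 (X \<inter> {0<..})"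
      by auto
    then have "card X = card (insert 0 (X \<inter> {0<..}))" by simp
    with True that show ?thesis by simp
  next
    case False
    then have "X \<inter> {0<..} = X"
      by (auto intro!: gr0I)
    with False show ?thesis by simp
  qed
  have "0 \<in> S \<longleftrightarrow> 0 \<in> T"
    using zero[OF assms(1)] zero[OF assms(2)] eq[of 0] assms(3)
    by (auto simp: gale_le_def split: if_splits)
  with pos show ?thesis
    by (metis not0_implies_Suc subsetI subset_antisym)
qed

text \<open>If one list is entrywise below another, every entry exceeding \<open>t\<close> in the
  first faces an entry exceeding \<open>t\<close> in the second. This links the order in
  \<open>order_ideal\<close> to the counting form.\<close>

lemma componentwise_le_imp_gale_le:
  assumes "finite S" "finite T" "S \<preceq>\<^sub>c T"
  shows "gale_le S T"
proof -
  have count: "card (X \<inter> {t<..}) = length (filter ((<) t) (sorted_list_of_set X))"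
    if "finite X" for X :: "nat set" and t
  proof -
    have "set (filter ((<) t) (sorted_list_of_set X)) = X \<inter> {t<..}"
      using that by auto
    then show ?thesis
      by (metis distinct_card distinct_filter distinct_sorted_list_of_set)
  qed
  have "length (filter ((<) t) xs) \<le> length (filter ((<) t) ys)"
    if "list_all2 (\<le>) xs ys" for xs ys :: "nat list" and t
    using that by (induction rule: list_all2_induct) auto
  with assms show ?thesis
    using list_all2_lengthD[of "(\<le>)" "sorted_list_of_set S" "sorted_list_of_set T"]
    unfolding gale_le_def componentwise_le_def by (auto simp: count)
qed

lemma card_exchange:
  assumes "finite S" "x \<in> S" "y \<notin> S"
  shows "card (insert y (S - {x})) = card S"
  using assms card_Suc_Diff1[of S x] by simp

text \<open>The loss of \<open>x\<close> stands on the left as a summand, which avoids truncated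
  subtraction.\<close>

lemma card_exchange_above:
  fixes S :: "nat set"
  assumes "finite S" "x \<in> S" "y \<notin> S"
  shows "card (insert y (S - {x}) \<inter> {t<..}) + of_bool (t < x) = card (S \<inter> {t<..}) + of_bool (t < y)"
proof -
  have "card ((S - {x}) \<inter> {t<..}) + of_bool (t < x) = card (S \<inter> {t<..})"
  proof (cases "t < x")
    case True
    then have "(S - {x}) \<inter> {t<..} = S \<inter> {t<..} - {x}" by auto
    with True assms show ?thesis
      using card_Suc_Diff1[of "S \<inter> {t<..}" x] by simp
  next
    case False
    then have "(S - {x}) \<inter> {t<..} = S \<inter> {t<..}" by auto
    with False show ?thesis by simp
  qed
  moreover have "card (insert y (S - {x}) \<inter> {t<..}) = card ((S - {x}) \<inter> {t<..}) + of_bool (t < y)"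
    using assms by (simp add: Int_insert_left)
  ultimately show ?thesis by simp
qed

lemma gale_le_exchange:
  assumes "finite S" "x \<in> S" "y \<notin> S" "y < x"
  shows "gale_le (insert y (S - {x})) S"
proof -
  have "card (insert y (S - {x}) \<inter> {t<..}) \<le> card (S \<inter> {t<..})" for t
    using card_exchange_above[OF assms(1-3), of t] assms(4)
    by (cases "t < y") auto
  then show ?thesis
    using card_exchange[OF assms(1-3)] by (simp add: gale_le_def)
qed

text \<open>Exchange \<open>x\<close> for the least element \<open>y\<close> of
  \<open>B - A\<close>. The count above \<open>t\<close> grows only if \<open>x \<le> t < y\<close>.
  Then all of \<open>B - A\<close> lies above \<open>t\<close> while \<open>x\<close> does not, and
  \<open>A - B\<close> has the same size as \<open>B - A\<close>, so \<open>A\<close> has strictly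
  fewer elements above \<open>t\<close> than \<open>B\<close> and there is room for one
  more.\<close>

lemma matroid_principal_matroid:
  assumes T: "T \<subseteq> {1..n}"
  shows "matroid (principal_matroid n T)"
proof -
  have exch: "\<exists>y\<in>B - A. insert y (A - {x}) \<in> bases (principal_matroid n T)"
    if A: "A \<in> bases (principal_matroid n T)" and B: "B \<in> bases (principal_matroid n T)"
      and x: "x \<in> A - B" for A B x
  proof -
    have fin: "finite A" "finite B"
      using A B by (auto intro: finite_subset)
    have cardeq: "card (A - B) = card (B - A)"
      using A B fin card_Diff_subset_Int[of A B] card_Diff_subset_Int[of B A]
      by (simp add: gale_le_def Int_commute)
    have ne: "B - A \<noteq> {}"
    proof
      assume "B - A = {}"
      with cardeq have "card (A - B) = 0" by (simp only: card.empty)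
      with fin x show False by auto
    qed
    define y where "y = Min (B - A)"
    have y: "y \<in> B - A"
      using Min_in[of "B - A"] ne fin by (simp add: y_def)
    have yle: "y \<le> z" if "z \<in> B - A" for z
      using that fin by (simp add: y_def)
    have "card (insert y (A - {x}) \<inter> {t<..}) \<le> card (T \<inter> {t<..})" for t
    proof (cases "x \<le> t \<and> t < y")
      case True
      have split: "card (X \<inter> {t<..}) = card (X \<inter> Y \<inter> {t<..}) + card ((X - Y) \<inter> {t<..})"
        if "finite X" for X Y
      proof -
        have "X \<inter> {t<..} = X \<inter> Y \<inter> {t<..} \<union> (X - Y) \<inter> {t<..}" by auto
        also have "card \<dots> = card (X \<inter> Y \<inter> {t<..}) + card ((X - Y) \<inter> {t<..})"
          using that by (intro card_Un_disjoint) auto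
        finally show ?thesis .
      qed
      have "card ((A - B) \<inter> {t<..}) \<le> card (A - B - {x})"
        using True fin by (intro card_mono) auto
      also have "\<dots> < card (A - B)"
        using fin x by (intro card_Diff1_less) auto
      finally have "card ((A - B) \<inter> {t<..}) < card (A - B)" .
      moreover have "(B - A) \<inter> {t<..} = B - A"
        using True yle by fastforce
      ultimately have "card (A \<inter> {t<..}) < card (B \<inter> {t<..})"
        using split[OF fin(1), of B] split[OF fin(2), of A] cardeq by (simp add: Int_commute)
      also have "\<dots> \<le> card (T \<inter> {t<..})"
        using B by (simp add: gale_le_def)
      finally show ?thesis
        using card_exchange_above[OF fin(1), of x y t] x y True by simp
    next
      case False
      then have "of_bool (t < y) \<le> (of_bool (t < x) :: nat)" by auto
      moreover have "x \<in> A" "y \<notin> A"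
        using x y by auto
      ultimately have "card (insert y (A - {x}) \<inter> {t<..}) \<le> card (A \<inter> {t<..})"
        using card_exchange_above[OF fin(1), of x y t] by linarith
      also have "\<dots> \<le> card (T \<inter> {t<..})"
        using A by (simp add: gale_le_def)
      finally show ?thesis .
    qed
    moreover have "card (insert y (A - {x})) = card T"
      using card_exchange[OF fin(1), of x y] x y A by (simp add: gale_le_def)
    moreover have "insert y (A - {x}) \<subseteq> {1..n}"
      using A B y by auto
    ultimately show ?thesis
      using y by (auto simp: gale_le_def)
  qed
  have mem: "T \<in> bases (principal_matroid n T)"
    using T by simp
  have sub: "bases (principal_matroid n T) \<subseteq> Pow (ground (principal_matroid n T))"
    by (auto simp: principal_matroid_def)
  show ?thesis
    unfolding matroid_def by (intro conjI ballI) (use exch mem sub in \<open>blast | simp\<close>)+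
qed

lemma shifted_principal_matroid:
  assumes T: "T \<subseteq> {1..n}"
  shows "shifted (principal_matroid n T)"
proof -
  let ?M = "principal_matroid n T"
  have "order_ideal n (card T) (bases ?M)"
    unfolding order_ideal_def
  proof (intro conjI ballI impI)
    show "bases ?M \<subseteq> nsets {1..n} (card T)"
      by (auto simp: nsets_def gale_le_def principal_matroid_def intro: finite_subset)
    fix U S assume "U \<in> bases ?M" "S \<in> nsets {1..n} (card T)" "S \<preceq>\<^sub>c U"
    then show "S \<in> bases ?M"
      using gale_le_trans[OF componentwise_le_imp_gale_le, of S U T]
      by (auto simp: nsets_def intro: finite_subset)
  qed
  moreover have "matroid_iso ?M ?M"
    unfolding matroid_iso_def by (intro exI[of _ id]) auto
  ultimately show ?thesis
    using matroid_principal_matroid[OF T] ground_principal_matroid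
    unfolding shifted_def by blast
qed

section \<open>Non-isomorphic shifted matroids\<close>

text \<open>Among the sets of a given size, a final segment has the least rank, so that the ranks
  of the final segments, which determine \<open>T\<close>, are isomorphism invariants.\<close>

lemma principal_matroid_rank_ge:
  assumes T: "T \<subseteq> {1..n}" and F: "F \<subseteq> {1..n}" "card F = n - t"
  shows "\<exists>B\<in>bases (principal_matroid n T). card (T \<inter> {t<..}) \<le> card (B \<inter> F)"
  using F
\<comment> \<open>Replacing an element of \<open>F\<close> by a larger one outside \<open>F\<close>
  raises the sum of \<open>F\<close>, which \<open>n * n\<close> bounds. The process ends at the
  final segment.\<close>
proof (induction "n * n - \<Sum>F" arbitrary: F rule: less_induct)
  case less
  have fin: "finite F"
    using less.prems(1) finite_subset by blast
  show ?case
  proof (cases "\<exists>a b. a \<in> F \<and> b \<in> {1..n} - F \<and> a < b")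
    case True
    then obtain a b where ab: "a \<in> F" "b \<in> {1..n} - F" "a < b" by blast
    let ?F = "insert b (F - {a})"
    have sub: "?F \<subseteq> {1..n}"
      using less.prems(1) ab by auto
    have "\<Sum>?F = b + \<Sum>(F - {a})"
      using ab fin by simp
    moreover have "\<Sum>F = a + \<Sum>(F - {a})"
      using ab sum.remove[OF fin, of a "\<lambda>x. x"] by simp
    ultimately have "\<Sum>F < \<Sum>?F"
      using ab by simp
    moreover have "\<Sum>?F \<le> n * n"
    proof -
      have "\<Sum>?F \<le> card ?F * n"
      proof -
        have "i \<le> n" if "i \<in> ?F" for i
          using sub that by auto
        from sum_bounded_above[of ?F "\<lambda>x. x" n, OF this] show ?thesis by simp
      qed
      also have "\<dots> \<le> n * n"
        using card_mono[OF _ sub] by (intro mult_right_mono) auto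
      finally show ?thesis .
    qed
    ultimately have "n * n - \<Sum>?F < n * n - \<Sum>F"
      by linarith
    moreover have "card ?F = n - t"
      using card_exchange[OF fin, of a b] ab less.prems(2) by simp
    ultimately obtain B where B: "B \<in> bases (principal_matroid n T)"
      "card (T \<inter> {t<..}) \<le> card (B \<inter> ?F)"
      using less.hyps sub by blast
    have finB: "finite B"
      using B by (auto intro: finite_subset)
    \<comment> \<open>A basis that is good for \<open>?F\<close> is carried back to
      \<open>F\<close>: if it contains \<open>b\<close> but not \<open>a\<close>, replacing
      \<open>b\<close> by the smaller \<open>a\<close> keeps it a basis, and otherwise it serves
      unchanged.\<close>
    show ?thesis
    proof (cases "b \<in> B \<and> a \<notin> B")
      case True
      let ?B = "insert a (B - {b})"
      have "gale_le ?B T"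
        using gale_le_trans[OF gale_le_exchange[OF finB, of b a]] True ab B by simp
      moreover have "?B \<subseteq> {1..n}"
        using B ab less.prems(1) by auto
      moreover have "?B \<inter> F = insert a (B \<inter> ?F - {b})"
        using True ab by auto
      then have "card (?B \<inter> F) = card (B \<inter> ?F)"
        using card_exchange[of "B \<inter> ?F" b a] finB True ab by simp
      ultimately show ?thesis
        using B(2) by (intro bexI[of _ ?B]) auto
    next
      case False
      have "card (B \<inter> ?F) \<le> card (B \<inter> F)"
      proof (cases "b \<in> B")
        case True
        with False have "a \<in> B" by simp
        have "B \<inter> ?F = insert b (B \<inter> F - {a})"
          using True by auto
        then show ?thesis
          using card_exchange[of "B \<inter> F" a b] finB True \<open>a \<in> B\<close> ab by simp
      next
        case False
        then show ?thesis
          using finB by (intro card_mono) auto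
      qed
      with B show ?thesis by (intro bexI[of _ B]) auto
    qed
  next
    case False
    \<comment> \<open>With no upward swap left, \<open>F\<close> is closed upwards in
      \<open>{1..n}\<close>, and its size fixes where it starts. Here \<open>T\<close> itself is the
      required basis.\<close>
    have "F = {t<..n}"
    proof (rule card_subset_eq)
      show "F \<subseteq> {t<..n}"
      proof (rule ccontr)
        assume "\<not> F \<subseteq> {t<..n}"
        then obtain a where "a \<in> F" "a \<notin> {t<..n}" by blast
        moreover from this less.prems(1) have "a \<in> {1..n}" by blast
        ultimately have a: "a \<in> F" "a \<le> t" "1 \<le> a" "a \<le> n" by simp_all
        have "{a..n} \<subseteq> F"
        proof
          fix b assume b: "b \<in> {a..n}"
          show "b \<in> F"
          proof (rule ccontr)
            assume "b \<notin> F"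
            with a(1) have "a \<noteq> b" by blast
            with b \<open>b \<notin> F\<close> a(3) have "a < b" "b \<in> {1..n} - F"
              by simp_all
            with False a(1) show False by blast
          qed
        qed
        then have "Suc n - a \<le> n - t"
          using card_mono[OF fin, of "{a..n}"] less.prems(2) by simp
        with a show False by linarith
      qed
    qed (use less.prems in auto)
    then have "T \<inter> F = T \<inter> {t<..}"
      using T by auto
    then show ?thesis
      using T by (intro bexI[of _ T]) auto
  qed
qed

text \<open>The isomorphism sends the final segment above \<open>t\<close> to a set of size
  \<open>n - t\<close>, which some basis for \<open>U\<close> meets in at least as many elements as
  \<open>U\<close> has above \<open>t\<close>. Pulled back, this is a basis for \<open>T\<close>,
  and it has at most as many elements above \<open>t\<close> as \<open>T\<close>.\<close>

lemma principal_matroid_iso_imp_gale_le: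
  assumes T: "T \<subseteq> {1..n}" and U: "U \<subseteq> {1..n}"
    and iso: "matroid_iso (principal_matroid n T) (principal_matroid n U)"
  shows "gale_le U T"
proof -
  obtain f where f: "bij_betw f {1..n} {1..n}"
    and bases: "bases (principal_matroid n U) = (\<lambda>B. f ` B) ` bases (principal_matroid n T)"
    using iso by (auto simp: matroid_iso_def)
  have inj: "inj_on f {1..n}"
    using f by (simp add: bij_betw_def)
  have "card (U \<inter> {t<..}) \<le> card (T \<inter> {t<..})" for t
  proof -
    have "{t<..n} \<subseteq> {1..n}" by auto
    then have "f ` {t<..n} \<subseteq> {1..n}" "card (f ` {t<..n}) = n - t"
      using f inj by (auto simp: bij_betw_def card_image inj_on_subset)
    from principal_matroid_rank_ge[OF U this]
    obtain B where "B \<in> bases (principal_matroid n U)"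
      and B: "card (U \<inter> {t<..}) \<le> card (B \<inter> f ` {t<..n})"
      by blast
    then obtain A where A: "A \<in> bases (principal_matroid n T)" "B = f ` A"
      unfolding bases by auto
    have "B \<inter> f ` {t<..n} = f ` (A \<inter> {t<..n})"
      unfolding A(2) using A(1) \<open>{t<..n} \<subseteq> {1..n}\<close>
      by (intro inj_on_image_Int[OF inj, symmetric]) auto
    also have "card \<dots> \<le> card (A \<inter> {t<..n})"
      by (intro card_image_le) auto
    also have "A \<inter> {t<..n} = A \<inter> {t<..}"
      using A(1) by auto
    also have "card \<dots> \<le> card (T \<inter> {t<..})"
      using A(1) by (simp add: gale_le_def)
    finally show ?thesis
      using B by simp
  qed
  moreover have "card U = card T"
  proof -
    have "U \<in> bases (principal_matroid n U)"
      using U by simp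
    then obtain A where A: "A \<in> bases (principal_matroid n T)" "U = f ` A"
      unfolding bases by blast
    then have "card U = card A"
      using inj by (auto intro: card_image inj_on_subset)
    with A show ?thesis by (simp add: gale_le_def)
  qed
  ultimately show ?thesis
    by (simp add: gale_le_def)
qed

section \<open>Counting isomorphism classes\<close>

lemma equiv_matroid_iso: "equiv {M. matroid M} (iso_rel {M :: nat bases_pair. matroid M})"
  by (rule equiv_iso_rel) simp

lemma matroid_iso_sym:
  fixes M N :: "nat bases_pair"
  assumes "matroid M" "matroid N" "matroid_iso M N"
  shows "matroid_iso N M"
proof -
  have "sym (iso_rel {M :: nat bases_pair. matroid M})"
    using equiv_matroid_iso by (simp add: equiv_def)
  then show ?thesis
    using assms symD[of "iso_rel {M :: nat bases_pair. matroid M}" M N]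
    by (simp add: iso_rel_def)
qed

lemma matroid_iso_trans:
  fixes L M N :: "nat bases_pair"
  assumes "matroid L" "matroid M" "matroid N" "matroid_iso L M" "matroid_iso M N"
  shows "matroid_iso L N"
proof -
  have "trans (iso_rel {M :: nat bases_pair. matroid M})"
    using equiv_matroid_iso by (simp add: equiv_def)
  then show ?thesis
    using assms transD[of "iso_rel {M :: nat bases_pair. matroid M}" L M N]
    by (simp add: iso_rel_def)
qed

text \<open>An infinite set has \<open>card\<close> 0, so a lower bound on the number of classes
  requires finiteness.\<close>

lemma finite_matroids_on:
  "finite {M :: nat bases_pair. matroid M \<and> ground M = {1..n} \<and> P M}"
proof (rule finite_subset)
  show "{M :: nat bases_pair. matroid M \<and> ground M = {1..n} \<and> P M} \<subseteq> {{1..n}} \<times> Pow (Pow {1..n})"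
  proof
    fix M assume "M \<in> {M :: nat bases_pair. matroid M \<and> ground M = {1..n} \<and> P M}"
    then have m: "matroid M" and g: "ground M = {1..n}" by simp_all
    have "bases M \<subseteq> Pow {1..n}"
      using m unfolding matroid_def g by blast
    with g show "M \<in> {{1..n}} \<times> Pow (Pow {1..n})"
      by (simp add: mem_Times_iff)
  qed
qed auto

lemma num_iso_classes_ge:
  assumes "\<And>i. i \<in> I \<Longrightarrow> matroid (M i) \<and> ground (M i) = {1..n} \<and> P (M i)"
    and "\<And>i j. i \<in> I \<Longrightarrow> j \<in> I \<Longrightarrow> matroid_iso (M i) (M j) \<Longrightarrow> i = j"
  shows "card I \<le> num_iso_classes P n"
proof -
  let ?C = "{M :: nat bases_pair. matroid M \<and> ground M = {1..n} \<and> P M}"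
  have eq: "equiv ?C (iso_rel ?C)"
    by (rule equiv_iso_rel) simp
  have "inj_on (\<lambda>i. iso_rel ?C `` {M i}) I"
  proof (rule inj_onI)
    fix i j assume ij: "i \<in> I" "j \<in> I" "iso_rel ?C `` {M i} = iso_rel ?C `` {M j}"
    then have "(M i, M j) \<in> iso_rel ?C"
      using eq_equiv_class[OF ij(3) eq] assms(1) by simp
    then show "i = j"
      using assms(2) ij by (simp add: iso_rel_def)
  qed
  moreover have "(\<lambda>i. iso_rel ?C `` {M i}) ` I \<subseteq> ?C // iso_rel ?C"
    using assms(1) by (auto intro!: quotientI)
  moreover have "finite (?C // iso_rel ?C)"
    using finite_matroids_on eq by (intro finite_quotient) (auto simp: equiv_def)
  ultimately show ?thesis
    unfolding num_iso_classes_def Let_def by (rule card_inj_on_le)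
qed

text \<open>The \<open>N i\<close> may lie outside the family being counted. A class is therefore
  recovered from \<open>i\<close> as the set of members isomorphic to \<open>N i\<close>, and so
  \<open>I\<close> maps onto a set containing all classes.\<close>

lemma num_iso_classes_le:
  fixes N :: "'i \<Rightarrow> nat bases_pair"
  assumes "finite I"
    and "\<And>i. i \<in> I \<Longrightarrow> matroid (N i)"
    and "\<And>M. matroid M \<Longrightarrow> ground M = {1..n} \<Longrightarrow> P M \<Longrightarrow> \<exists>i\<in>I. matroid_iso M (N i)"
  shows "num_iso_classes P n \<le> card I"
proof -
  let ?C = "{M :: nat bases_pair. matroid M \<and> ground M = {1..n} \<and> P M}"
  have eq: "equiv ?C (iso_rel ?C)"
    by (rule equiv_iso_rel) simp
  have "?C // iso_rel ?C \<subseteq> (\<lambda>i. {M \<in> ?C. matroid_iso M (N i)}) ` I"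
  proof
    fix X assume "X \<in> ?C // iso_rel ?C"
    then obtain M where M: "M \<in> ?C" "X = iso_rel ?C `` {M}"
      by (elim quotientE)
    then obtain i where i: "i \<in> I" "matroid_iso M (N i)"
      using assms(3) by blast
    have "matroid_iso M L \<longleftrightarrow> matroid_iso L (N i)" if "L \<in> ?C" for L
    proof -
      have m: "matroid M" "matroid L" "matroid (N i)"
        using that M(1) assms(2)[OF i(1)] by simp_all
      show ?thesis
      proof
        assume iso: "matroid_iso M L"
        show "matroid_iso L (N i)"
          by (rule matroid_iso_trans[OF m(2,1,3) matroid_iso_sym[OF m(1,2) iso] i(2)])
      next
        assume iso: "matroid_iso L (N i)"
        show "matroid_iso M L"
          by (rule matroid_iso_trans[OF m(1,3,2) i(2) matroid_iso_sym[OF m(2,3) iso]])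
      qed
    qed
    then have "X = {M \<in> ?C. matroid_iso M (N i)}"
      using M by (auto simp: iso_rel_def)
    with i show "X \<in> (\<lambda>i. {M \<in> ?C. matroid_iso M (N i)}) ` I"
      by blast
  qed
  then show ?thesis
    unfolding num_iso_classes_def Let_def using assms(1) surj_card_le by blast
qed

lemma Sh_ge: "2 ^ n \<le> Sh n"
proof -
  have "card (Pow {1..n}) \<le> Sh n"
    unfolding Sh_def
  proof (rule num_iso_classes_ge[where M = "principal_matroid n"])
    fix T U assume "T \<in> Pow {1..n}" "U \<in> Pow {1..n}"
      and iso: "matroid_iso (principal_matroid n T) (principal_matroid n U)"
    then have TU: "T \<subseteq> {1..n}" "U \<subseteq> {1..n}" by auto
    then have "matroid_iso (principal_matroid n U) (principal_matroid n T)"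
      using iso matroid_iso_sym matroid_principal_matroid by blast
    then show "T = U"
      using principal_matroid_iso_imp_gale_le TU iso
      by (intro gale_le_antisym) (auto intro: finite_subset)
  qed (use matroid_principal_matroid shifted_principal_matroid in auto)
  then show ?thesis
    by (simp add: card_Pow)
qed

section \<open>Threshold matroids are few\<close>

lemma matroid_exchange:
  assumes "matroid M" "A \<in> bases M" "B \<in> bases M" "x \<in> A - B"
  shows "\<exists>y\<in>B - A. insert y (A - {x}) \<in> bases M"
  using assms unfolding matroid_def by blast

text \<open>Gale's optimality property of matroids: a basis \<open>T\<close> with the largest
  element sum dominates all others. Exchanging an element of \<open>A - T\<close> that is at most
  \<open>t\<close> for one of \<open>T\<close> does not lower the count of \<open>A\<close> above
  \<open>t\<close>, so induction reduces to the case where \<open>A - T\<close> lies above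
  \<open>t\<close>.\<close>

lemma gale_maximum_basis_exists:
  fixes M :: "nat bases_pair"
  assumes M: "matroid M"
  obtains T where "T \<in> bases M" "\<And>A. A \<in> bases M \<Longrightarrow> gale_le A T"
proof -
  have finb: "finite (bases M)"
    using M unfolding matroid_def by (meson finite_Pow_iff finite_subset)
  have fin: "finite A" if "A \<in> bases M" for A
    using M that unfolding matroid_def by (meson PowD finite_subset subsetD)
  note exch = matroid_exchange[OF M]
  have "bases M \<noteq> {}"
    using M by (simp add: matroid_def)
  then have "Max (sum id ` bases M) \<in> sum id ` bases M"
    using finb by (intro Max_in) auto
  then obtain T where T: "T \<in> bases M" "\<Sum>T = Max (sum id ` bases M)"
    by (auto simp: id_def)
  have Tmax: "\<Sum>A \<le> \<Sum>T" if "A \<in> bases M" for A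
    using that finb Max_ge[of "sum id ` bases M" "\<Sum>A"] T(2) by (auto simp: id_def)
  note T = T(1)
  have "card (A \<inter> {t<..}) \<le> card (T \<inter> {t<..})" if "A \<in> bases M" for A t
    using that
  proof (induction "card (A - T)" arbitrary: A rule: less_induct)
    case less
    note A = less.prems
    show ?case
    proof (cases "\<exists>x. x \<in> A - T \<and> x \<le> t")
      case True
      then obtain x where x: "x \<in> A - T" "x \<le> t" by blast
      obtain y where y: "y \<in> T - A" "insert y (A - {x}) \<in> bases M"
        using exch[OF A T x(1)] by blast
      have "insert y (A - {x}) - T \<subset> A - T"
        using x y by auto
      then have "card (insert y (A - {x}) - T) < card (A - T)"
        using fin[OF A] by (intro psubset_card_mono) auto
      from less.hyps[OF this y(2)] show ?thesis
        using card_exchange_above[OF fin[OF A], of x y t] x y by simp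
    next
      case False
      show ?thesis
      proof (rule ccontr)
        assume "\<not> ?thesis"
        then have lt: "card (T \<inter> {t<..}) < card (A \<inter> {t<..})" by simp
        have split: "card X = card (X \<inter> {t<..}) + card (X \<inter> {..t})" if "finite X" for X :: "nat set"
        proof -
          have "X = X \<inter> {t<..} \<union> X \<inter> {..t}" by auto
          then show ?thesis
            using card_Un_disjoint[of "X \<inter> {t<..}" "X \<inter> {..t}"] that by fastforce
        qed
        \<comment> \<open>As \<open>A\<close> and \<open>T\<close> have equal size, more elements
          above \<open>t\<close> means fewer below. Some \<open>x \<le> t\<close> of
          \<open>T - A\<close> can then be exchanged for an element of \<open>A - T\<close>, which
          lies above \<open>t\<close>, against the maximality of the sum of
          \<open>T\<close>.\<close>
        have "card (A \<inter> {..t}) < card (T \<inter> {..t})"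
          using split[OF fin[OF A]] split[OF fin[OF T]] lt matroid_card_bases_eq[OF M A T]
          by linarith
        then have "\<not> T \<inter> {..t} \<subseteq> A \<inter> {..t}"
          using fin[OF A] card_mono[of "A \<inter> {..t}" "T \<inter> {..t}"] by fastforce
        then obtain x where x: "x \<in> T - A" "x \<le> t" by auto
        obtain y where y: "y \<in> A - T" "insert y (T - {x}) \<in> bases M"
          using exch[OF T A x(1)] by blast
        have "t < y"
          using False y(1) by auto
        moreover have "\<Sum>T = x + \<Sum>(T - {x})"
          using x sum.remove[OF fin[OF T], of x "\<lambda>x. x"] by simp
        ultimately have "\<Sum>T < \<Sum>(insert y (T - {x}))"
          using x y fin[OF T] by simp
        with Tmax[OF y(2)] show False by simp
      qed
    qed
  qed
  then have "gale_le A T" if "A \<in> bases M" for A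
    using that matroid_card_bases_eq[OF M that T] by (simp add: gale_le_def)
  with T show ?thesis by (rule that)
qed

text \<open>Matching the largest elements of \<open>S\<close> and \<open>T\<close>, then the next
  largest, and so on pairs each element of \<open>S\<close> with one of \<open>T\<close> that is at
  least as large and hence has at most its weight.\<close>

lemma sum_antimono_gale_le:
  fixes v :: "nat \<Rightarrow> real"
  assumes "antimono_on {1..n} v" "S \<subseteq> {1..n}" "T \<subseteq> {1..n}" "gale_le S T"
  shows "sum v T \<le> sum v S"
  using assms(2-4)
proof (induction "card S" arbitrary: S T)
  case 0
  then have "S = {}" "T = {}"
    by (auto simp: gale_le_def dest: finite_subset)
  then show ?case by simp
next
  case (Suc k)
  have fin: "finite S" "finite T"
    using Suc.prems finite_subset by blast+
  have ne: "S \<noteq> {}" "T \<noteq> {}"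
    using Suc.hyps(2) Suc.prems(3) by (auto simp: gale_le_def)
  have count: "card (S \<inter> {t<..}) \<le> card (T \<inter> {t<..})" for t
    using Suc.prems(3) by (simp add: gale_le_def)
  let ?s = "Max S" and ?t = "Max T"
  have s: "?s \<in> S" and t: "?t \<in> T"
    using fin ne by auto
  have "T \<inter> {?t<..} = {}"
    using fin Max_ge[of T] by (auto simp flip: not_le)
  with count[of ?t] fin have "S \<inter> {?t<..} = {}"
    by simp
  with s have st: "?s \<le> ?t"
    by (metis IntI empty_iff greaterThan_iff linorder_not_le)
  have "gale_le (S - {?s}) (T - {?t})"
    unfolding gale_le_def
  proof (intro conjI allI)
    show "card (S - {?s}) = card (T - {?t})"
      using fin s t Suc.prems(3) by (simp add: gale_le_def)
    fix u
    show "card ((S - {?s}) \<inter> {u<..}) \<le> card ((T - {?t}) \<inter> {u<..})"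
    proof (cases "u < ?s")
      case True
      have "(S - {?s}) \<inter> {u<..} = S \<inter> {u<..} - {?s}" "(T - {?t}) \<inter> {u<..} = T \<inter> {u<..} - {?t}"
        by auto
      then show ?thesis
        using True st s t fin count[of u] by (simp add: diff_le_mono)
    next
      case False
      then have "(S - {?s}) \<inter> {u<..} = {}"
        using fin Max_ge[of S] by fastforce
      then show ?thesis by simp
    qed
  qed
  moreover have "k = card (S - {?s})"
    using Suc.hyps(2) fin s by simp
  ultimately have "sum v (T - {?t}) \<le> sum v (S - {?s})"
    using Suc.hyps(1)[of "S - {?s}" "T - {?t}"] Suc.prems(1,2) by blast
  moreover have "v ?t \<le> v ?s"
    using assms(1) st s t Suc.prems(1,2) by (auto simp: monotone_on_def)
  ultimately show ?case
    using sum.remove[OF fin(1) s, of v] sum.remove[OF fin(2) t, of v] by simp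
qed

lemma matroid_iso_image:
  assumes M: "matroid M" and f: "inj_on f (ground M)"
  shows "matroid (f ` ground M, (\<lambda>B. f ` B) ` bases M)"
proof -
  have sub: "B \<subseteq> ground M" if "B \<in> bases M" for B
    using M that by (auto simp: matroid_def)
  have exch: "\<exists>y\<in>f ` B - f ` A. insert y (f ` A - {x}) \<in> (\<lambda>B. f ` B) ` bases M"
    if A: "A \<in> bases M" and B: "B \<in> bases M" and "x \<in> f ` A - f ` B" for A B x
  proof -
    obtain a where a: "a \<in> A - B" "x = f a"
      using \<open>x \<in> f ` A - f ` B\<close> by auto
    obtain b where b: "b \<in> B - A" "insert b (A - {a}) \<in> bases M"
      using matroid_exchange[OF M A B a(1)] by blast
    have "f b \<notin> f ` A"
      using b(1) sub[OF A] sub[OF B] inj_on_image_mem_iff[OF f, of b A] by auto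
    moreover have "f ` (A - {a}) = f ` A - {f a}"
      using inj_on_image_set_diff[OF f, of A "{a}"] sub[OF A] a by auto
    then have "insert (f b) (f ` A - {x}) = f ` insert b (A - {a})"
      using a by simp
    ultimately show ?thesis
      using b by blast
  qed
  show ?thesis
    unfolding matroid_def fst_conv snd_conv
  proof (intro conjI ballI)
    show "finite (f ` ground M)" "(\<lambda>B. f ` B) ` bases M \<noteq> {}"
      using M by (simp_all add: matroid_def)
    show "(\<lambda>B. f ` B) ` bases M \<subseteq> Pow (f ` ground M)"
      using sub by blast
    fix A B x
    assume "A \<in> (\<lambda>B. f ` B) ` bases M" "B \<in> (\<lambda>B. f ` B) ` bases M" "x \<in> A - B"
    then show "\<exists>y\<in>B - A. insert y (A - {x}) \<in> (\<lambda>B. f ` B) ` bases M"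
      using exch by (elim imageE) simp
  qed
qed

lemma sorting_permutation:
  fixes w :: "nat \<Rightarrow> real"
  obtains g where "bij_betw g {1..n} {1..n}" "antimono_on {1..n} (w \<circ> g)"
proof -
  define xs where "xs = sort_key (\<lambda>i. - w i) [1..<Suc n]"
  have xs: "length xs = n" "distinct xs" "set xs = {1..n}" "sorted (map (\<lambda>i. - w i) xs)"
    by (auto simp: xs_def simp del: upt_Suc)
  \<comment> \<open>Lists are indexed from 0 and the ground set starts at 1. The sort key
    \<open>- w i\<close> puts the heaviest element first.\<close>
  define g where "g i = xs ! (i - 1)" for i
  have "bij_betw (\<lambda>i. i - 1) {1..n} {..<n}"
    by (rule bij_betw_byWitness[where f' = Suc]) auto
  moreover have "bij_betw ((!) xs) {..<n} {1..n}"
    using bij_betw_nth[of xs "{..<n}" "{1..n}"] xs by simp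
  ultimately have "bij_betw g {1..n} {1..n}"
    using bij_betw_trans by (fastforce simp: g_def[abs_def] comp_def)
  moreover have "antimono_on {1..n} (w \<circ> g)"
  proof (rule monotone_onI)
    fix i j assume "i \<in> {1..n}" "j \<in> {1..n}" "i \<le> j"
    then show "(w \<circ> g) j \<le> (w \<circ> g) i"
      using sorted_nth_mono[OF xs(4), of "i - 1" "j - 1"] xs(1) by (simp add: g_def)
  qed
  ultimately show ?thesis by (rule that)
qed

section \<open>Alternating patterns and threshold weights\<close>

text \<open>From position \<open>l\<close> on, the 0/1 sequence of \<open>T\<close> has a subsequence \<open>(01)\<^sup>m\<close>.\<close>

fun alternating :: "nat \<Rightarrow> nat \<Rightarrow> nat set \<Rightarrow> bool" where
  "alternating 0 l T \<longleftrightarrow> True"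
| "alternating (Suc m) l T \<longleftrightarrow> (\<exists>z x. l \<le> z \<and> z < x \<and> z \<notin> T \<and> x \<in> T \<and> alternating m (Suc x) T)"

text \<open>Compared with two copies of \<open>T\<close>, the two bases together lose
  \<open>x1\<close>, ..., \<open>x4\<close> and gain \<open>z1\<close>, ..., \<open>z4\<close>, and
  so do the two non-bases. Their total weights agree, yet the first would be positive and the second
  at most 0.\<close>

lemma not_alternating_if_weights:
  fixes v :: "nat \<Rightarrow> real"
  assumes T: "T \<subseteq> {1..n}"
    and v: "\<And>B. B \<subseteq> {1..n} \<Longrightarrow> card B = card T \<Longrightarrow> gale_le B T \<longleftrightarrow> 0 < sum v B"
  shows "\<not> alternating 4 1 T"
proof
  assume "alternating 4 1 T"
  then obtain z1 x1 z2 x2 z3 x3 z4 x4 where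
    zx: "1 \<le> z1" "z1 < x1" "x1 < z2" "z2 < x2" "x2 < z3" "z3 < x3" "x3 < z4" "z4 < x4"
    and z: "z1 \<notin> T" "z2 \<notin> T" "z3 \<notin> T" "z4 \<notin> T"
    and x: "x1 \<in> T" "x2 \<in> T" "x3 \<in> T" "x4 \<in> T"
    by (auto simp: numeral_eq_Suc Suc_le_eq)
  have fin: "finite T"
    using T finite_subset by blast
  have "x4 \<le> n"
    using T x by auto
  have ex: "insert b (insert d (T - {a, c})) \<subseteq> {1..n}"
    "card (insert b (insert d (T - {a, c}))) = card T"
    "sum v (insert b (insert d (T - {a, c}))) = sum v T - v a - v c + v b + v d"
    if "a \<in> T" "c \<in> T" "b \<notin> T" "d \<notin> T" "a \<noteq> c" "b \<noteq> d" "1 \<le> b" "b \<le> n" "1 \<le> d" "d \<le> n"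
    for a b c d
  proof -
    have "T - {a, c} = T - {a} - {c}" by auto
    then have "card T = card (T - {a, c}) + 2" "sum v T = sum v (T - {a, c}) + v a + v c"
      using that fin card_Suc_Diff1[of T a] card_Suc_Diff1[of "T - {a}" c]
        sum.remove[of T a v] sum.remove[of "T - {a}" c v]
      by auto
    then show "card (insert b (insert d (T - {a, c}))) = card T"
      "sum v (insert b (insert d (T - {a, c}))) = sum v T - v a - v c + v b + v d"
      using that fin by auto
    show "insert b (insert d (T - {a, c})) \<subseteq> {1..n}"
      using that T by auto
  qed
  \<comment> \<open>Two downward exchanges in succession: \<open>c\<close> for \<open>d\<close>,
    then \<open>a\<close> for \<open>b\<close>.\<close>
  have down: "gale_le (insert b (insert d (T - {a, c}))) T"
    if "a \<in> T" "c \<in> T" "b \<notin> T" "d \<notin> T" "b < a" "a < d" "d < c" for a b c d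
  proof -
    have "gale_le (insert b (insert d (T - {c}) - {a})) (insert d (T - {c}))"
      using that fin by (intro gale_le_exchange) auto
    moreover have "gale_le (insert d (T - {c})) T"
      using that fin by (intro gale_le_exchange) auto
    moreover have "insert b (insert d (T - {a, c})) = insert b (insert d (T - {c}) - {a})"
      using that by auto
    ultimately show ?thesis
      using gale_le_trans by metis
  qed
  text \<open>\<open>?N1\<close> has too many elements above \<open>x1\<close>, and \<open>?N2\<close> has too many above \<open>x3\<close>.\<close>
  let ?B1 = "insert z1 (insert z2 (T - {x1, x2}))" and ?B2 = "insert z3 (insert z4 (T - {x3, x4}))"
  let ?N1 = "insert z2 (insert z3 (T - {x1, x4}))" and ?N2 = "insert z1 (insert z4 (T - {x2, x3}))"
  have "0 < sum v ?B1"
    using v[OF ex(1,2), of x1 x2 z1 z2] down[of x1 x2 z1 z2] zx z x \<open>x4 \<le> n\<close> by simp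
  moreover have "0 < sum v ?B2"
    using v[OF ex(1,2), of x3 x4 z3 z4] down[of x3 x4 z3 z4] zx z x \<open>x4 \<le> n\<close> by simp
  moreover have "\<not> gale_le ?N1 T"
  proof -
    have "?N1 \<inter> {x1<..} = insert z3 (insert z2 (T \<inter> {x1<..} - {x4}))"
      using zx by auto
    then have "card (?N1 \<inter> {x1<..}) = Suc (card (T \<inter> {x1<..}))"
      using card_exchange[of "T \<inter> {x1<..}" x4 z2] fin zx z x by simp
    then show ?thesis
      unfolding gale_le_def by (metis Suc_n_not_le_n)
  qed
  then have "\<not> 0 < sum v ?N1"
    using v[OF ex(1,2), of x1 x4 z2 z3] zx z x \<open>x4 \<le> n\<close> by simp
  moreover have "\<not> gale_le ?N2 T"
  proof -
    have "?N2 \<inter> {x3<..} = insert z4 (T \<inter> {x3<..})"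
      using zx by auto
    then have "card (?N2 \<inter> {x3<..}) = Suc (card (T \<inter> {x3<..}))"
      using fin z by simp
    then show ?thesis
      unfolding gale_le_def by (metis Suc_n_not_le_n)
  qed
  then have "\<not> 0 < sum v ?N2"
    using v[OF ex(1,2), of x2 x3 z1 z4] zx z x \<open>x4 \<le> n\<close> by simp
  moreover have "sum v ?B1 + sum v ?B2 = sum v ?N1 + sum v ?N2"
    using ex(3)[of x1 x2 z1 z2] ex(3)[of x3 x4 z3 z4] ex(3)[of x1 x4 z2 z3] ex(3)[of x2 x3 z1 z4]
      zx z x \<open>x4 \<le> n\<close> by simp
  ultimately show False by linarith
qed

text \<open>Once the elements are relabelled by decreasing weight, a set below the maximum basis
  \<open>T\<close> weighs at least as much as \<open>T\<close>, so it is a basis too.\<close>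

lemma threshold_imp_iso_principal_matroid:
  fixes M :: "nat bases_pair"
  assumes M: "matroid M" "ground M = {1..n}" and thr: "threshold M"
  obtains T where "T \<subseteq> {1..n}" "\<not> alternating 4 1 T" "matroid_iso M (principal_matroid n T)"
proof -
  obtain k and w :: "nat \<Rightarrow> real" where k: "has_rank M k"
    and w: "\<forall>B\<in>nsets {1..n} k. B \<in> bases M \<longleftrightarrow> 0 < sum w B"
    using thr unfolding threshold_def M(2) by blast
  obtain g where g: "bij_betw g {1..n} {1..n}" "antimono_on {1..n} (w \<circ> g)"
    by (rule sorting_permutation)
  let ?v = "w \<circ> g"
  \<comment> \<open>\<open>f\<close> sends an element to its position in the order of decreasing
    weight, so the relabelled matroid \<open>N\<close> has the antitone weights
    \<open>w \<circ> g\<close>.\<close>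
  define f where "f = the_inv_into {1..n} g"
  have f: "bij_betw f {1..n} {1..n}"
    unfolding f_def using g(1) by (rule bij_betw_the_inv_into)
  have gf: "g (f i) = i" if "i \<in> {1..n}" for i
    using that g(1) by (simp add: f_def f_the_inv_into_f_bij_betw)
  have fg: "f (g i) = i" if "i \<in> {1..n}" for i
    using that g(1) by (simp add: f_def bij_betw_def the_inv_into_f_f)
  define N where "N = ({1..n}, (\<lambda>B. f ` B) ` bases M)"
  have N: "matroid N"
    using matroid_iso_image[OF M(1), of f] f M(2) by (simp add: N_def bij_betw_def)
  have sub: "B \<subseteq> {1..n}" if "B \<in> bases M" for B
    using M that by (auto simp: matroid_def)
  have basesN: "B \<in> bases N \<longleftrightarrow> 0 < sum ?v B" if B: "B \<subseteq> {1..n}" "card B = k" for B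
  proof -
    have inj: "inj_on g B"
      using g(1) B(1) by (auto simp: bij_betw_def intro: inj_on_subset)
    have "g ` B \<in> nsets {1..n} k"
      using B g(1) inj by (auto simp: nsets_def bij_betw_def card_image intro: finite_subset)
    then have "g ` B \<in> bases M \<longleftrightarrow> 0 < sum ?v B"
      using w sum.reindex[OF inj, of w] by simp
    moreover have "f ` g ` B = B"
      using B(1) fg by (force simp: image_image)
    moreover have "g ` f ` A = A" if "A \<in> bases M" for A
      using sub[OF that] gf by (force simp: image_image)
    ultimately show ?thesis
      unfolding N_def by (auto simp: image_iff)
  qed
  obtain T where T: "T \<in> bases N" "\<And>A. A \<in> bases N \<Longrightarrow> gale_le A T"
    using gale_maximum_basis_exists[OF N] by blast
  have subN: "B \<subseteq> {1..n}" if "B \<in> bases N" for B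
    using N that by (auto simp: matroid_def N_def)
  have cardT: "card T = k"
  proof -
    obtain A where A: "A \<in> bases M" "T = f ` A"
      using T(1) by (auto simp: N_def)
    then have "card T = card A"
      using f sub[OF A(1)] by (auto simp: bij_betw_def intro: card_image inj_on_subset)
    with A k show ?thesis by (simp add: has_rank_def)
  qed
  have char: "B \<in> bases N \<longleftrightarrow> gale_le B T" if "B \<subseteq> {1..n}" for B
  proof
    assume B: "gale_le B T"
    have "0 < sum ?v T"
      using basesN[OF subN[OF T(1)] cardT] T(1) by simp
    also have "\<dots> \<le> sum ?v B"
      using sum_antimono_gale_le[OF g(2) that subN[OF T(1)] B] .
    finally show "B \<in> bases N"
      using basesN[OF that] B cardT by (simp add: gale_le_def)
  qed (rule T(2))
  have "bases N = bases (principal_matroid n T)"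
  proof (intro set_eqI)
    show "B \<in> bases N \<longleftrightarrow> B \<in> bases (principal_matroid n T)" for B
      using subN[of B] char[of B] by (auto simp only: mem_bases_principal_matroid)
  qed
  then have "N = principal_matroid n T"
    by (simp add: prod_eq_iff N_def)
  moreover have "matroid_iso M N"
    using f M(2) by (auto simp: matroid_iso_def N_def)
  ultimately have "matroid_iso M (principal_matroid n T)" by simp
  moreover have "\<not> alternating 4 1 T"
    using not_alternating_if_weights[OF subN[OF T(1)], of ?v] basesN char cardT by blast
  ultimately show ?thesis
    using that subN[OF T(1)] by blast
qed

text \<open>Greedy decomposition: let \<open>b\<close> be the first gap from \<open>l\<close> on and
  \<open>x\<close> the first element of \<open>T\<close> after it. The pair \<open>b\<close>,
  \<open>x\<close> uses up one level of the pattern, so the part after \<open>x\<close> avoids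
  \<open>m\<close> levels. Each level contributes the two intervals \<open>{l..<b}\<close> and
  \<open>{x..<Suc x}\<close>.\<close>

lemma not_alternating_imp_intervals:
  assumes "\<not> alternating m l T" "T \<subseteq> {l..n}" "l \<le> Suc n"
  shows "\<exists>xs. length xs = 2 * m \<and> set xs \<subseteq> {..Suc n} \<times> {..Suc n} \<and> T = (\<Union>(a, b)\<in>set xs. {a..<b})"
  using assms
proof (induction m arbitrary: l T)
  case 0
  then show ?case by simp
next
  case (Suc m)
  define b where "b = (LEAST i. l \<le> i \<and> i \<notin> T)"
  \<comment> \<open>\<open>Suc n\<close> is a sentinel outside \<open>T\<close>, so \<open>b\<close>
    exists even if \<open>T\<close> fills \<open>{l..n}\<close>.\<close>
  have bound: "l \<le> Suc n \<and> Suc n \<notin> T"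
    using Suc.prems by auto
  have "l \<le> b \<and> b \<notin> T"
    unfolding b_def using bound by (rule LeastI)
  moreover have "b \<le> Suc n"
    unfolding b_def using bound by (rule Least_le)
  ultimately have b: "l \<le> b" "b \<notin> T" "b \<le> Suc n" by auto
  have init: "{l..<b} \<subseteq> T"
  proof
    fix i assume "i \<in> {l..<b}"
    then show "i \<in> T"
      using not_less_Least[of i "\<lambda>i. l \<le> i \<and> i \<notin> T"] by (auto simp: b_def)
  qed
  show ?case
  proof (cases "\<exists>x\<in>T. b < x")
    case False
    then have "T \<subseteq> {l..<b}"
    proof (intro subsetI)
      fix y assume "y \<in> T"
      moreover from this have "y \<noteq> b" "l \<le> y"
        using Suc.prems(2) b(2) by auto
      ultimately show "y \<in> {l..<b}"
        using False by (auto simp: not_less)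
    qed
    with init have "T = {l..<b}" by simp
    then show ?thesis
      using b Suc.prems(3)
      \<comment> \<open>Copies of one interval pad the list to the exact length, so that only lists
        of a fixed length have to be counted.\<close>
      by (intro exI[of _ "replicate (2 * Suc m) (l, b)"]) (auto simp: set_replicate_conv_if)
  next
    case True
    define x where "x = (LEAST x. x \<in> T \<and> b < x)"
    have x: "x \<in> T" "b < x"
      using True LeastI_ex[of "\<lambda>x. x \<in> T \<and> b < x"] unfolding x_def by blast+
    have least: "x \<le> y" if "y \<in> T" "b < y" for y
      unfolding x_def by (rule Least_le) (use that in simp)
    have "x \<le> n"
      using x Suc.prems(2) by auto
    \<comment> \<open>A pattern that starts at \<open>l'\<close> sees only the part of
      \<open>T\<close> from \<open>l'\<close> on.\<close>
    have "alternating m l' T" if "alternating m l' (T \<inter> {l'..})" for l'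
    proof -
      have "alternating i j T" if "alternating i j (T \<inter> {l'..})" "l' \<le> j" for i j
        using that
      proof (induction i arbitrary: j)
        case (Suc i)
        then obtain z y where "j \<le> z" "z < y" "z \<notin> T \<inter> {l'..}" "y \<in> T"
          "alternating i (Suc y) (T \<inter> {l'..})"
          by auto
        moreover from this Suc.prems(2) have "z \<notin> T" by auto
        ultimately show ?case
          using Suc.IH[of "Suc y"] Suc.prems(2) by auto
      qed simp
      from this[OF that] show ?thesis by simp
    qed
    then have "\<not> alternating m (Suc x) (T \<inter> {Suc x..})"
      using Suc.prems(1) x b by auto
    moreover have "T \<inter> {Suc x..} \<subseteq> {Suc x..n}"
      using Suc.prems(2) by auto
    ultimately obtain xs where xs: "length xs = 2 * m" "set xs \<subseteq> {..Suc n} \<times> {..Suc n}"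
      "T \<inter> {Suc x..} = (\<Union>(a, b)\<in>set xs. {a..<b})"
      using Suc.IH \<open>x \<le> n\<close> by (metis Suc_le_mono)
    have "T = {l..<b} \<union> {x..<Suc x} \<union> T \<inter> {Suc x..}"
    proof
      show "T \<subseteq> {l..<b} \<union> {x..<Suc x} \<union> T \<inter> {Suc x..}"
      proof
        fix y assume y: "y \<in> T"
        then have "l \<le> y" "y \<noteq> b"
          using Suc.prems(2) b by auto
        then show "y \<in> {l..<b} \<union> {x..<Suc x} \<union> T \<inter> {Suc x..}"
          using y least[of y] by (cases "y < b") auto
      qed
    qed (use init x in auto)
    then have "T = (\<Union>(a, b)\<in>set ((l, b) # (x, Suc x) # xs). {a..<b})"
      unfolding xs(3) by (simp add: Un_assoc)
    moreover have "set ((l, b) # (x, Suc x) # xs) \<subseteq> {..Suc n} \<times> {..Suc n}"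
      using xs(2) b Suc.prems(3) \<open>x \<le> n\<close> by auto
    ultimately show ?thesis
      using xs(1) by (intro exI[of _ "(l, b) # (x, Suc x) # xs"]) simp
  qed
qed

text \<open>Each of the \<open>2 * m\<close> intervals has two endpoints, and each endpoint is one
  of the \<open>n + 2\<close> numbers up to \<open>Suc n\<close>.\<close>

lemma card_not_alternating_le: "card {T. T \<subseteq> {1..n} \<and> \<not> alternating m 1 T} \<le> (n + 2) ^ (4 * m)"
proof -
  let ?L = "{xs. set xs \<subseteq> {..Suc n} \<times> {..Suc n} \<and> length xs = 2 * m}"
  have fin: "finite ?L"
    by (intro finite_lists_length_eq) auto
  have "{T. T \<subseteq> {1..n} \<and> \<not> alternating m 1 T} \<subseteq> (\<lambda>xs. \<Union>(a, b)\<in>set xs. {a..<b}) ` ?L"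
    using not_alternating_imp_intervals[of m 1 _ n] by fastforce
  then have "card {T. T \<subseteq> {1..n} \<and> \<not> alternating m 1 T} \<le> card ?L"
    using fin by (rule surj_card_le[rotated])
  also have "\<dots> = ((n + 2) * (n + 2)) ^ (2 * m)"
    by (subst card_lists_length_eq) auto
  also have "\<dots> = ((n + 2) ^ 2) ^ (2 * m)"
    by (simp add: power2_eq_square)
  also have "\<dots> = (n + 2) ^ (4 * m)"
    by (simp flip: power_mult)
  finally show ?thesis .
qed

section \<open>Polynomial against exponential growth\<close>

lemma Th_le: "Th n \<le> (n + 2) ^ 16"
proof -
  have "Th n \<le> card {T. T \<subseteq> {1..n} \<and> \<not> alternating 4 1 T}"
    unfolding Th_def
  proof (rule num_iso_classes_le[where N = "principal_matroid n"])
    show "finite {T. T \<subseteq> {1..n} \<and> \<not> alternating 4 1 T}"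
      by (rule finite_subset[of _ "Pow {1..n}"]) auto
    show "\<exists>T\<in>{T. T \<subseteq> {1..n} \<and> \<not> alternating 4 1 T}. matroid_iso M (principal_matroid n T)"
      if "matroid M" "ground M = {1..n}" "threshold M" for M
      using threshold_imp_iso_principal_matroid[OF that] by blast
  qed (simp add: matroid_principal_matroid)
  also have "\<dots> \<le> (n + 2) ^ 16"
    using card_not_alternating_le[of n 4] by simp
  finally show ?thesis .
qed

theorem theorem1:
  shows "(\<lambda>n. real (Th n) / real (Sh n)) \<longlonglongrightarrow> 0"
proof (rule tendsto_0_le[where K = 1])
  have "real (Th n) / real (Sh n) \<le> (real n + 2) ^ 16 / 2 ^ n" for n
  proof (rule frac_le)
    show "real (Th n) \<le> (real n + 2) ^ 16"
      using of_nat_mono[OF Th_le[of n], where 'a = real] by (simp add: add.commute)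
    show "2 ^ n \<le> real (Sh n)"
      using of_nat_mono[OF Sh_ge[of n], where 'a = real] by simp
  qed auto
  then show "\<forall>\<^sub>F n in sequentially. norm (real (Th n) / real (Sh n)) \<le> norm ((real n + 2) ^ 16 / 2 ^ n) * 1"
    by simp
  \<comment> \<open>With \<open>c = root 16 (1 / 2) < 1\<close>, the sequence
    \<open>n * c ^ n\<close> tends to 0. Its 16th power is \<open>n ^ 16 / 2 ^ n\<close>.\<close>
  have "(\<lambda>n. (real n * root 16 (1 / 2) ^ n) ^ 16) \<longlonglongrightarrow> 0 ^ 16"
    by (intro tendsto_power powser_times_n_limit_0) simp
  moreover have "(root 16 (1 / 2) ^ n) ^ 16 = (root 16 (1 / 2 :: real) ^ 16) ^ n" for n
    by (simp only: mult.commute flip: power_mult)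
  ultimately have "(\<lambda>n. real n ^ 16 * (1 / 2) ^ n) \<longlonglongrightarrow> 0"
    by (simp add: power_mult_distrib)
  \<comment> \<open>The shift by 2 produces the base \<open>n + 2\<close>. The factor 4 below
    compensates for the two extra halvings.\<close>
  then have "(\<lambda>n. real (n + 2) ^ 16 * (1 / 2) ^ (n + 2)) \<longlonglongrightarrow> 0"
    by (rule LIMSEQ_ignore_initial_segment)
  from tendsto_mult_left[OF this, of 4]
  show "(\<lambda>n. (real n + 2) ^ 16 / 2 ^ n :: real) \<longlonglongrightarrow> 0"
    by (simp add: power_divide add.commute)
qed

end
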